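(* Let $\mathcal A=\{1,\dots,m\}$, $\mathbb X=\mathcal A^{\mathbb Z}$ with left shift $S$, $\mu=\mu_0^{\mathbb Z}$ with $\mu_0$ a probability measure on $\mathcal A$ satisfying $\mu_0(\{a\})>0$ for all $a$, and $\nu=\mu\times\mu'$ where $\mu'$ is normalized counting measure on $\mathbb Z_2$. Let $T(x,j)=(Sx,j+1\bmod 2)$ on $\mathbb X\times\mathbb Z_2$, let $g:\mathcal A\times\mathbb Z_2\to\mathbb R$, $f(x,j)=g(x_0,j)$, and $H_\omega=\Delta+V_\omega$ with $V_\omega(n)=f(T^n\omega)$. For $a,b\in\mathcal A$ let $\omega_{ab}=((ab)^{\mathbb Z},0)$, where $(ab)^{\mathbb Z}$ has $a$ at even and $b$ at odd positions. Then for $\nu$-almost every $\omega$, $$\sigma(H_\omega)=\bigcup_{a,b\in\mathcal A}\sigma(H_{\omega_{ab}}),$$ and for every $\omega\in\mathbb X\times\mathbb Z_2$, $\sigma(H_\omega)\subseteq\bigcup_{a,b\in\mathcal A}\sigma(H_{\omega_{ab}})$.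
   Context: $\Delta$ is the discrete Laplacian $(\Delta\psi)(n)=\psi(n+1)+\psi(n-1)$ on $\ell^2(\mathbb Z)$. *)

theory Defs
  imports "HOL-Probability.Probability"
begin

definition l2Z :: "(int \<Rightarrow> complex) set" where
  "l2Z = {\<psi>. (\<lambda>n. (cmod (\<psi> n))\<^sup>2) summable_on UNIV}"

definition lap :: "(int \<Rightarrow> complex) \<Rightarrow> int \<Rightarrow> complex" where
  "lap \<psi> n = \<psi> (n + 1) + \<psi> (n - 1)"

definition schr :: "(int \<Rightarrow> real) \<Rightarrow> (int \<Rightarrow> complex) \<Rightarrow> int \<Rightarrow> complex" where
  "schr V \<psi> n = lap \<psi> n + complex_of_real (V n) * \<psi> n"

text \<open>Spectrum of the (bounded) operator schr V on l2(Z): the set of z for which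
  schr V - z is not a bijection of l2(Z) (bounded inverse is then automatic).\<close>
definition op_spectrum :: "(int \<Rightarrow> real) \<Rightarrow> complex set" where
  "op_spectrum V = {z. \<not> bij_betw (\<lambda>\<psi> n. schr V \<psi> n - z * \<psi> n) l2Z l2Z}"

definition shift :: "(int \<Rightarrow> nat) \<Rightarrow> int \<Rightarrow> nat" where
  "shift x n = x (n + 1)"

definition shift_inv :: "(int \<Rightarrow> nat) \<Rightarrow> int \<Rightarrow> nat" where
  "shift_inv x n = x (n - 1)"

definition T :: "(int \<Rightarrow> nat) \<times> nat \<Rightarrow> (int \<Rightarrow> nat) \<times> nat" where
  "T \<omega> = (shift (fst \<omega>), (snd \<omega> + 1) mod 2)"

definition T_inv :: "(int \<Rightarrow> nat) \<times> nat \<Rightarrow> (int \<Rightarrow> nat) \<times> nat" where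
  "T_inv \<omega> = (shift_inv (fst \<omega>), (snd \<omega> + 1) mod 2)"

definition Tpow :: "int \<Rightarrow> (int \<Rightarrow> nat) \<times> nat \<Rightarrow> (int \<Rightarrow> nat) \<times> nat" where
  "Tpow n = (if n \<ge> 0 then T ^^ nat n else T_inv ^^ nat (- n))"

definition pot :: "(nat \<Rightarrow> nat \<Rightarrow> real) \<Rightarrow> (int \<Rightarrow> nat) \<times> nat \<Rightarrow> int \<Rightarrow> real" where
  "pot g \<omega> n = (let \<omega>' = Tpow n \<omega> in g (fst \<omega>' 0) (snd \<omega>'))"

definition XZ2 :: "nat \<Rightarrow> ((int \<Rightarrow> nat) \<times> nat) set" where
  "XZ2 m = {(x, j). (\<forall>n. x n \<in> {1..m}) \<and> j \<in> {0, 1}}"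

definition omega_ab :: "nat \<Rightarrow> nat \<Rightarrow> (int \<Rightarrow> nat) \<times> nat" where
  "omega_ab a b = ((\<lambda>n. if even n then a else b), 0)"

definition nu :: "nat pmf \<Rightarrow> ((int \<Rightarrow> nat) \<times> nat) measure" where
  "nu \<mu>0 = (PiM UNIV (\<lambda>_::int. measure_pmf \<mu>0)) \<Otimes>\<^sub>M measure_pmf (pmf_of_set {0, 1::nat})"

end

theory Submission
  imports Defs
begin

text \<open>
  Write \<open>\<alpha> = g a 0\<close>, \<open>\<beta> = g b 1\<close>. The spectrum of the two-periodic operator is the set of real \<open>E\<close>
  with \<open>0 \<le> (\<alpha> - E) (\<beta> - E) \<le> 4\<close>. If a real \<open>E\<close> lies in none of these sets, put \<open>s n = sgn (V n - E)\<close>.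
  In \<open>Re \<langle>s \<psi>, (H - E) \<psi>\<rangle>\<close> the bonds between sites of opposite sign cancel, and the bonds between
  sites of equal sign are absorbed by the diagonal, since there \<open>\<bar>V n - E\<bar> \<bar>V (n + 1) - E\<bar> > 4\<close>.
  So the form is coercive, and \<open>H - E\<close> is inverted by a damped fixed-point iteration;
  for non-real \<open>E\<close> the same works with the constant \<open>s = - \<i> sgn (Im E)\<close>.
  Conversely, almost every configuration contains arbitrarily long disjoint blocks \<open>abab\<dots>\<close> starting
  at sites of the right parity; cutting off a bounded solution of the periodic equation to these
  blocks yields a right-hand side outside the range of \<open>H - E\<close>.
\<close>

section \<open>Coercive Jacobi operators\<close>

lemma l2Z_sum_le_infsum:
  assumes "\<psi> \<in> l2Z" "finite F"
  shows "(\<Sum>n\<in>F. (cmod (\<psi> n))\<^sup>2) \<le> (\<Sum>\<^sub>\<infinity>n. (cmod (\<psi> n))\<^sup>2)"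
  using assms unfolding l2Z_def by (intro finite_sum_le_infsum) auto

lemma l2Z_cmod_le:
  assumes "\<psi> \<in> l2Z"
  shows "cmod (\<psi> n) \<le> sqrt (\<Sum>\<^sub>\<infinity>n. (cmod (\<psi> n))\<^sup>2)"
  using l2Z_sum_le_infsum[OF assms, of "{n}"] by (simp add: real_le_rsqrt)

lemma l2Z_bounded_sumsI:
  assumes "\<And>F. finite F \<Longrightarrow> (\<Sum>n\<in>F. (cmod (\<psi> n))\<^sup>2) \<le> B"
  shows "\<psi> \<in> l2Z"
  unfolding l2Z_def using assms
  by (auto intro!: nonneg_bounded_partial_sums_imp_summable_on[where C = B] eventually_finite_subsets_at_top_weakI)

lemma l2Z_diff:
  assumes "\<psi> \<in> l2Z" "\<eta> \<in> l2Z"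
  shows "(\<lambda>n. \<psi> n - \<eta> n) \<in> l2Z"
proof -
  have "(cmod (\<psi> n - \<eta> n))\<^sup>2 \<le> 2 * (cmod (\<psi> n))\<^sup>2 + 2 * (cmod (\<eta> n))\<^sup>2" for n
    using norm_triangle_ineq4[of "\<psi> n" "\<eta> n"]
      sum_squares_bound[of "cmod (\<psi> n)" "cmod (\<eta> n)"]
      power_mono[of "cmod (\<psi> n - \<eta> n)" "cmod (\<psi> n) + cmod (\<eta> n)" 2]
    by (simp add: power2_sum)
  moreover have "(\<lambda>n. 2 * (cmod (\<psi> n))\<^sup>2 + 2 * (cmod (\<eta> n))\<^sup>2) summable_on UNIV"
    using assms unfolding l2Z_def by (intro summable_on_add summable_on_cmult_right) auto
  ultimately show ?thesis
    unfolding l2Z_def by (auto intro: summable_on_comparison_test)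
qed

lemma infsum_int_shift:
  "(\<Sum>\<^sub>\<infinity>n. f (n + k :: int)) = (\<Sum>\<^sub>\<infinity>n. f n)"
  using infsum_reindex_bij_betw[of "\<lambda>n. n + k" UNIV UNIV f]
  by (metis bij_plus_right)

lemma summable_on_int_shift:
  "(\<lambda>n. f (n + k :: int)) summable_on UNIV \<longleftrightarrow> f summable_on UNIV"
  using summable_on_reindex_bij_betw[of "\<lambda>n. n + k" UNIV UNIV f]
  by (metis bij_plus_right)

lemma L2_set_sum_le:
  "L2_set (\<lambda>n. \<Sum>i\<in>I. f i n) F \<le> (\<Sum>i\<in>I. L2_set (f i) F)" if "finite I"
  using that
proof induction
  case empty then show ?case by (simp add: L2_set_def)
next
  case (insert i I)
  then show ?case using L2_set_triangle_ineq[of "f i" "\<lambda>n. \<Sum>i\<in>I. f i n" F] by simp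
qed

text \<open>The diagonal is complex so that \<open>schr V\<close> minus any spectral parameter is
  again of this form.\<close>

definition jac :: "(int \<Rightarrow> complex) \<Rightarrow> (int \<Rightarrow> complex) \<Rightarrow> int \<Rightarrow> complex" where
  "jac D \<psi> n = lap \<psi> n + D n * \<psi> n"

lemma schr_minus_eq_jac:
  "schr V \<psi> n - z * \<psi> n = jac (\<lambda>n. complex_of_real (V n) - z) \<psi> n"
  by (simp add: schr_def jac_def algebra_simps)

lemma power2_sum3_le: "(a + b + c :: real)\<^sup>2 \<le> 3 * (a\<^sup>2 + b\<^sup>2 + c\<^sup>2)"
  using sum_squares_bound[of a b] sum_squares_bound[of a c] sum_squares_bound[of b c]
  by (simp add: power2_eq_square algebra_simps)

lemma cmod_jac_power2_le:
  assumes "cmod (D n) \<le> K"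
  shows "(cmod (jac D \<psi> n))\<^sup>2
    \<le> 3 * ((cmod (\<psi> (n + 1)))\<^sup>2 + (cmod (\<psi> (n - 1)))\<^sup>2 + K\<^sup>2 * (cmod (\<psi> n))\<^sup>2)"
proof -
  have "cmod (jac D \<psi> n) \<le> cmod (\<psi> (n + 1)) + cmod (\<psi> (n - 1)) + cmod (D n * \<psi> n)"
    unfolding jac_def lap_def by (metis norm_triangle_le norm_triangle_ineq add_right_mono)
  also have "\<dots> \<le> cmod (\<psi> (n + 1)) + cmod (\<psi> (n - 1)) + K * cmod (\<psi> n)"
    using assms by (simp add: norm_mult mult_right_mono)
  finally have "(cmod (jac D \<psi> n))\<^sup>2 \<le> (cmod (\<psi> (n + 1)) + cmod (\<psi> (n - 1)) + K * cmod (\<psi> n))\<^sup>2"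
    by (intro power_mono) auto
  also have "\<dots> \<le> 3 * ((cmod (\<psi> (n + 1)))\<^sup>2 + (cmod (\<psi> (n - 1)))\<^sup>2 + (K * cmod (\<psi> n))\<^sup>2)"
    by (rule power2_sum3_le)
  finally show ?thesis by (simp add: power_mult_distrib)
qed

lemma jac_in_l2Z:
  assumes D: "\<And>n. cmod (D n) \<le> K" and "\<psi> \<in> l2Z"
  shows "jac D \<psi> \<in> l2Z"
proof -
  let ?a = "\<lambda>n. (cmod (\<psi> n))\<^sup>2"
  have a: "?a summable_on UNIV" using assms by (simp add: l2Z_def)
  have "(\<lambda>n. ?a (n + 1)) summable_on UNIV" "(\<lambda>n. ?a (n + (-1))) summable_on UNIV"
    using summable_on_int_shift[of ?a 1] summable_on_int_shift[of ?a "-1"] a by auto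
  then have "(\<lambda>n. 3 * (?a (n + 1) + ?a (n - 1) + K\<^sup>2 * ?a n)) summable_on UNIV"
    using a by (intro summable_on_cmult_right summable_on_add) auto
  then show ?thesis
    unfolding l2Z_def using cmod_jac_power2_le[of D _ K \<psi>, OF D]
    by (auto intro: summable_on_comparison_test)
qed

text \<open>The unimodular multiplier \<open>s\<close> makes the real part of the form positive. The
  number \<open>r n\<close> is the share of the diagonal that site \<open>n\<close> spends on each
  of its two bonds, whence the factor 2; \<open>c\<close> is what remains. By \<open>hop\<close>, a
  bond either cancels or is paid for by the shares of its two ends.\<close>

locale coercive_jac =
  fixes D s :: "int \<Rightarrow> complex" and r :: "int \<Rightarrow> real" and c K :: real
  assumes c_pos: "0 < c"
    and D_bounded: "\<And>n. cmod (D n) \<le> K"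
    and cmod_s: "\<And>n. cmod (s n) = 1"
    and r_nonneg: "\<And>n. 0 \<le> r n"
    and Re_D: "\<And>n. 2 * r n + c \<le> Re (cnj (s n) * D n)"
    and hop: "\<And>n. cnj (s n) + s (n + 1) = 0 \<or> 1 \<le> r n * r (n + 1)"
begin

lemma Re_D_le: "Re (cnj (s n) * D n) \<le> K"
  using complex_Re_le_cmod[of "cnj (s n) * D n"] D_bounded[of n] cmod_s[of n]
  by (simp add: norm_mult)

lemma c_le_K: "c \<le> K"
  using Re_D[of 0] Re_D_le[of 0] r_nonneg[of 0] by linarith

lemma r_le_K: "r n \<le> K"
  using Re_D[of n] Re_D_le[of n] c_pos r_nonneg[of n] by linarith

text \<open>The bond contribution of the sites \<open>n\<close> and \<open>n - 1\<close>, arranged so that it telescopes.\<close>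
definition bond :: "(int \<Rightarrow> complex) \<Rightarrow> int \<Rightarrow> real" where
  "bond \<psi> n = r n * (cmod (\<psi> n))\<^sup>2 + Re (s n * (cnj (\<psi> (n - 1)) * \<psi> n))"

text \<open>A nonvanishing coefficient has modulus at most 2, and then
  \<open>1 \<le> r n * r (n + 1)\<close> lets the arithmetic-geometric mean inequality absorb the
  product.\<close>

lemma hop_bound:
  "- (r n * (cmod x)\<^sup>2) - r (n + 1) * (cmod y)\<^sup>2 \<le> Re ((cnj (s n) + s (n + 1)) * (cnj x * y))"
proof (cases "cnj (s n) + s (n + 1) = 0")
  case True
  moreover have "0 \<le> r n * (cmod x)\<^sup>2" "0 \<le> r (n + 1) * (cmod y)\<^sup>2"
    using r_nonneg by auto
  ultimately show ?thesis by simp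
next
  case False
  then have rr: "1 \<le> r n * r (n + 1)" using hop by blast
  let ?x = "cmod x" and ?y = "cmod y"
  have "cmod (cnj (s n) + s (n + 1)) \<le> 2"
    using norm_triangle_ineq[of "cnj (s n)" "s (n + 1)"] cmod_s by simp
  then have "cmod ((cnj (s n) + s (n + 1)) * (cnj x * y)) \<le> 2 * (?x * ?y)"
    by (simp add: norm_mult mult_right_mono)
  moreover have "?x * ?y \<le> sqrt (r n * r (n + 1)) * (?x * ?y)"
    using rr by (simp add: mult_le_cancel_right1 mult_less_0_iff)
  moreover have "2 * (sqrt (r n * r (n + 1)) * (?x * ?y)) \<le> r n * ?x\<^sup>2 + r (n + 1) * ?y\<^sup>2"
    using sum_squares_bound[of "sqrt (r n) * ?x" "sqrt (r (n + 1)) * ?y"] r_nonneg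
    by (simp add: power_mult_distrib real_sqrt_mult ac_simps)
  ultimately show ?thesis
    using abs_Re_le_cmod[of "(cnj (s n) + s (n + 1)) * (cnj x * y)"] by linarith
qed

text \<open>Local form of coercivity. The hop to the left is conjugated into
  \<open>bond \<psi> n\<close>; the hop to the right is combined, through \<open>hop_bound\<close>,
  with the left hop of site \<open>n + 1\<close>. Summed over all sites the bonds telescope away and
  leave \<open>c\<close> times the squared norm.\<close>

lemma Re_inner_jac:
  "c * (cmod (\<psi> n))\<^sup>2 + bond \<psi> n - bond \<psi> (n + 1) \<le> Re (cnj (s n * \<psi> n) * jac D \<psi> n)"
proof -
  let ?w = "\<lambda>n. cnj (\<psi> n) * \<psi> (n + 1)"
  have "Re (cnj (s n * \<psi> n) * jac D \<psi> n) =
      Re (cnj (s n) * D n) * (cmod (\<psi> n))\<^sup>2 + Re (cnj (s n) * ?w n)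
      + Re (s n * (cnj (\<psi> (n - 1)) * \<psi> n))"
    unfolding jac_def lap_def cmod_power2 by (simp add: algebra_simps power2_eq_square)
  moreover have "(2 * r n + c) * (cmod (\<psi> n))\<^sup>2 \<le> Re (cnj (s n) * D n) * (cmod (\<psi> n))\<^sup>2"
    using Re_D by (intro mult_right_mono) auto
  moreover have "Re ((cnj (s n) + s (n + 1)) * ?w n) = Re (cnj (s n) * ?w n) + Re (s (n + 1) * ?w n)"
    by (simp add: algebra_simps)
  ultimately show ?thesis
    using hop_bound[of n "\<psi> n" "\<psi> (n + 1)"]
    unfolding bond_def by (simp add: algebra_simps del: complex_cnj_mult times_complex.sel)
qed

lemma bond_summable:
  assumes "\<psi> \<in> l2Z"
  shows "bond \<psi> summable_on UNIV"
proof -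
  let ?a = "\<lambda>n. (cmod (\<psi> n))\<^sup>2"
  have a: "?a summable_on UNIV" using assms by (simp add: l2Z_def)
  have a': "(\<lambda>n. ?a (n + (-1))) summable_on UNIV"
    using summable_on_int_shift[of ?a "-1"] a by auto
  have "norm (bond \<psi> n) \<le> (K + 1) * ?a n + ?a (n + (-1))" for n
  proof -
    have "\<bar>Re (s n * (cnj (\<psi> (n - 1)) * \<psi> n))\<bar> \<le> cmod (\<psi> (n - 1)) * cmod (\<psi> n)"
      using abs_Re_le_cmod[of "s n * (cnj (\<psi> (n - 1)) * \<psi> n)"] cmod_s[of n]
      by (simp add: norm_mult)
    also have "\<dots> \<le> ?a (n - 1) + ?a n"
      using sum_squares_bound[of "cmod (\<psi> (n - 1))" "cmod (\<psi> n)"]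
        mult_nonneg_nonneg[of "cmod (\<psi> (n - 1))" "cmod (\<psi> n)", OF norm_ge_zero norm_ge_zero]
      unfolding mult.assoc by linarith
    finally have 1: "\<bar>Re (s n * (cnj (\<psi> (n - 1)) * \<psi> n))\<bar> \<le> ?a (n - 1) + ?a n" .
    have "0 \<le> r n * ?a n" "r n * ?a n \<le> K * ?a n"
      using r_nonneg r_le_K by (auto intro: mult_right_mono)
    with 1 show ?thesis
      unfolding bond_def by (simp add: algebra_simps)
  qed
  moreover have "(\<lambda>n. (K + 1) * ?a n + ?a (n + (-1))) summable_on UNIV"
    by (intro summable_on_add summable_on_cmult_right a a')
  ultimately have "(\<lambda>n. norm (bond \<psi> n)) summable_on UNIV"
    by (intro Infinite_Sum.abs_summable_on_comparison_test'[of "\<lambda>n. (K + 1) * ?a n + ?a (n + (-1))"])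
  then show ?thesis by (rule summable_on_iff_abs_summable_on_real[THEN iffD2])
qed

section \<open>Inversion by a contracting iteration\<close>

definition tau :: real where "tau = c / (3 * (2 + K\<^sup>2))"
definition rate :: real where "rate = 1 - c * tau"
text \<open>One damped Richardson step for \<open>jac D \<psi> = 0\<close>, with the multiplier
  \<open>cnj (s n)\<close> turning coercivity into decrease of the norm.\<close>

definition relax :: "(int \<Rightarrow> complex) \<Rightarrow> int \<Rightarrow> complex" where
  "relax \<psi> n = \<psi> n - of_real tau * cnj (s n) * jac D \<psi> n"

lemma tau_pos: "0 < tau"
  unfolding tau_def using c_pos by (simp add: add_pos_nonneg)

lemma rate: "0 \<le> rate" "rate < 1"
proof -
  have "c * c \<le> K * K" using c_pos c_le_K by (intro mult_mono) auto
  then have "c * c \<le> 3 * (2 + K\<^sup>2)" by (simp add: power2_eq_square) (smt (verit) mult_nonneg_nonneg zero_le_square)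
  then have "c * tau \<le> 1" unfolding tau_def
    by (simp add: divide_le_eq add_pos_nonneg)
  then show "0 \<le> rate" by (simp add: rate_def)
  show "rate < 1" using tau_pos c_pos by (simp add: rate_def)
qed

lemma relax_in_l2Z:
  assumes "\<psi> \<in> l2Z" shows "relax \<psi> \<in> l2Z"
proof -
  have "jac D \<psi> \<in> l2Z" using jac_in_l2Z D_bounded assms by blast
  then have "(\<lambda>n. of_real tau * cnj (s n) * jac D \<psi> n) \<in> l2Z"
    unfolding l2Z_def by (simp add: norm_mult power_mult_distrib cmod_s summable_on_cmult_right)
  then show ?thesis using l2Z_diff[OF assms] unfolding relax_def by simp
qed

text \<open>Expanding the square, the cross term gains \<open>2 * c * tau\<close> by
  \<open>Re_inner_jac\<close>, while the quadratic term costs at most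
  \<open>3 * (2 + K\<^sup>2) * tau\<^sup>2\<close> by the bound on \<open>jac D\<close>.\<close>

lemma relax_contraction:
  assumes "\<psi> \<in> l2Z"
  shows "(\<Sum>\<^sub>\<infinity>n. (cmod (relax \<psi> n))\<^sup>2) \<le> rate * (\<Sum>\<^sub>\<infinity>n. (cmod (\<psi> n))\<^sup>2)"
proof -
  let ?a = "\<lambda>n. (cmod (\<psi> n))\<^sup>2"
  have a: "?a summable_on UNIV" using assms by (simp add: l2Z_def)
  have ap: "(\<lambda>n. ?a (n + 1)) summable_on UNIV" and am: "(\<lambda>n. ?a (n + (-1))) summable_on UNIV"
    using summable_on_int_shift[of ?a 1] summable_on_int_shift[of ?a "-1"] a by auto
  have b: "bond \<psi> summable_on UNIV" and bp: "(\<lambda>n. bond \<psi> (n + 1)) summable_on UNIV"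
    using bond_summable[OF assms] summable_on_int_shift[of "bond \<psi>" 1] by auto
  \<comment> \<open>Pointwise majorant of the relaxed sequence. The difference of bonds and the
    second difference of the squared moduli are kept explicit because each sums to zero by shift
    invariance.\<close>
  define R where "R = (\<lambda>n. rate * ?a n + (2 * tau) * (bond \<psi> (n + 1) + - bond \<psi> n)
      + 3 * tau\<^sup>2 * (?a (n + 1) + ?a (n + (-1)) + (-2) * ?a n))"
  have hs: "(?a has_sum infsum ?a UNIV) UNIV" "((\<lambda>n. ?a (n + 1)) has_sum infsum ?a UNIV) UNIV"
    "((\<lambda>n. ?a (n + (-1))) has_sum infsum ?a UNIV) UNIV"
    "(bond \<psi> has_sum infsum (bond \<psi>) UNIV) UNIV"
    "((\<lambda>n. bond \<psi> (n + 1)) has_sum infsum (bond \<psi>) UNIV) UNIV"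
    using has_sum_infsum[OF a] has_sum_infsum[OF b] has_sum_infsum[OF ap] infsum_int_shift[of ?a 1]
      has_sum_infsum[OF am] infsum_int_shift[of ?a "-1"]
      has_sum_infsum[OF bp] infsum_int_shift[of "bond \<psi>" 1]
    by simp_all
  have "(R has_sum (rate * infsum ?a UNIV + (2 * tau) * (infsum (bond \<psi>) UNIV + - infsum (bond \<psi>) UNIV)
      + 3 * tau\<^sup>2 * (infsum ?a UNIV + infsum ?a UNIV + (-2) * infsum ?a UNIV))) UNIV"
    unfolding R_def
    by (intro has_sum_add has_sum_cmult_right has_sum_uminus[THEN iffD2] hs) (simp add: hs)
  then have R: "(R has_sum (rate * infsum ?a UNIV)) UNIV" by simp
  have le: "(cmod (relax \<psi> n))\<^sup>2 \<le> R n" for n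
  proof -
    let ?A = "jac D \<psi> n"
    have "(cmod (relax \<psi> n))\<^sup>2 = ?a n - 2 * tau * Re (cnj (s n * \<psi> n) * ?A) + tau\<^sup>2 * (cmod ?A)\<^sup>2"
    proof -
      have "(cmod (\<psi> n - of_real tau * (cnj (s n) * ?A)))\<^sup>2
          = ?a n - 2 * tau * Re (cnj (\<psi> n) * (cnj (s n) * ?A)) + tau\<^sup>2 * (cmod (cnj (s n) * ?A))\<^sup>2"
        unfolding cmod_power2 by (simp add: power2_eq_square algebra_simps)
      then show ?thesis unfolding relax_def by (simp add: norm_mult cmod_s mult.assoc mult.left_commute)
    qed
    also have "\<dots> \<le> ?a n - 2 * tau * (c * ?a n + bond \<psi> n - bond \<psi> (n + 1))
        + tau\<^sup>2 * (3 * (?a (n + 1) + ?a (n - 1) + K\<^sup>2 * ?a n))"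
      using Re_inner_jac[of \<psi> n] tau_pos cmod_jac_power2_le[of D n K \<psi>, OF D_bounded]
      by (intro add_mono diff_mono mult_left_mono) auto
    also have "\<dots> = R n + (tau * (3 * (2 + K\<^sup>2) * tau) - c * tau) * ?a n"
      unfolding R_def rate_def by (simp add: algebra_simps power2_eq_square)
    \<comment> \<open>\<open>tau\<close> is the minimizer of
      \<open>1 - 2 * c * tau + 3 * (2 + K\<^sup>2) * tau\<^sup>2\<close>, and the minimum is
      \<open>rate\<close>.\<close>
    also have "3 * (2 + K\<^sup>2) * tau = c"
      unfolding tau_def by (simp add: add_pos_nonneg[THEN less_imp_neq, symmetric])
    finally show ?thesis by simp
  qed
  have "(\<Sum>\<^sub>\<infinity>n. (cmod (relax \<psi> n))\<^sup>2) \<le> infsum R UNIV"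
    using le has_sum_imp_summable[OF R] relax_in_l2Z[OF assms] unfolding l2Z_def by (intro infsum_mono) auto
  then show ?thesis using infsumI[OF R] by simp
qed

lemma iter_l2Z:
  assumes "b \<in> l2Z"
  shows "(relax ^^ i) b \<in> l2Z"
    and "(\<Sum>\<^sub>\<infinity>n. (cmod ((relax ^^ i) b n))\<^sup>2) \<le> rate ^ i * (\<Sum>\<^sub>\<infinity>n. (cmod (b n))\<^sup>2)"
proof -
  have "(relax ^^ i) b \<in> l2Z \<and>
    (\<Sum>\<^sub>\<infinity>n. (cmod ((relax ^^ i) b n))\<^sup>2) \<le> rate ^ i * (\<Sum>\<^sub>\<infinity>n. (cmod (b n))\<^sup>2)"
  proof (induction i)
    case 0 then show ?case using assms by simp
  next
    case (Suc i)
    then show ?case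
      using relax_in_l2Z relax_contraction[of "(relax ^^ i) b"] rate
      by (auto intro: order_trans[OF _ mult_left_mono] simp: mult.assoc)
  qed
  then show "(relax ^^ i) b \<in> l2Z"
    "(\<Sum>\<^sub>\<infinity>n. (cmod ((relax ^^ i) b n))\<^sup>2) \<le> rate ^ i * (\<Sum>\<^sub>\<infinity>n. (cmod (b n))\<^sup>2)"
    by auto
qed

text \<open>The Neumann series of the iterates of \<open>b\<close> solves
  \<open>\<psi> = relax \<psi> + b\<close>, which is the desired equation multiplied by
  \<open>tau * cnj (s n)\<close>. The series is formed site by site; membership in
  \<open>l2Z\<close> comes from uniform bounds over finite sets.\<close>

lemma surj_jac:
  assumes "\<phi> \<in> l2Z"
  shows "\<exists>\<psi>\<in>l2Z. jac D \<psi> = \<phi>"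
proof -
  define b where "b = (\<lambda>n. of_real tau * cnj (s n) * \<phi> n)"
  define it where "it = (\<lambda>i. (relax ^^ i) b)"
  define N where "N = sqrt (\<Sum>\<^sub>\<infinity>n. (cmod (b n))\<^sup>2)"
  define \<psi> where "\<psi> = (\<lambda>n. \<Sum>i. it i n)"
  \<comment> \<open>The contraction acts on squared norms, so norms decay with the square
    root.\<close>
  let ?q = "sqrt rate"
  have b: "b \<in> l2Z"
    using assms unfolding b_def l2Z_def
    by (simp add: norm_mult power_mult_distrib cmod_s summable_on_cmult_right)
  have q: "norm ?q < 1" using rate by (simp add: real_sqrt_lt_1_iff)
  have L2: "L2_set (\<lambda>n. cmod (it i n)) F \<le> ?q ^ i * N" if "finite F" for i F
  proof -
    have "(\<Sum>n\<in>F. (cmod (it i n))\<^sup>2) \<le> rate ^ i * (\<Sum>\<^sub>\<infinity>n. (cmod (b n))\<^sup>2)"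
      using l2Z_sum_le_infsum[OF iter_l2Z(1)[OF b] that, of i] iter_l2Z(2)[OF b, of i]
      unfolding it_def by linarith
    then show ?thesis
      unfolding L2_set_def N_def real_sqrt_power[symmetric] real_sqrt_mult[symmetric]
      by (rule real_sqrt_le_mono)
  qed
  have geo: "(\<lambda>i. ?q ^ i * N) sums (1 / (1 - ?q) * N)"
    by (intro sums_mult2 geometric_sums q)
  have summ: "summable (\<lambda>i. it i n)" for n
  proof (rule summable_comparison_test'[where N = 0 and g = "\<lambda>i. ?q ^ i * N"])
    show "summable (\<lambda>i. ?q ^ i * N)" using geo by (rule sums_summable)
    show "norm (it i n) \<le> ?q ^ i * N" for i using L2[of "{n}" i] by (simp add: L2_set_def)
  qed
  have "\<psi> \<in> l2Z"
  proof (rule l2Z_bounded_sumsI)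
    fix F :: "int set" assume F: "finite F"
    \<comment> \<open>The triangle inequality bounds the partial sums independently of
      \<open>k\<close>, and over a finite set the bound survives the pointwise limit.\<close>
    have "(\<lambda>k. L2_set (\<lambda>n. cmod (\<Sum>i<k. it i n)) F) \<longlonglongrightarrow> L2_set (\<lambda>n. cmod (\<psi> n)) F"
      unfolding L2_set_def \<psi>_def using summ
      by (intro tendsto_intros) (auto simp: sums_def[symmetric] summable_sums)
    moreover have "L2_set (\<lambda>n. cmod (\<Sum>i<k. it i n)) F \<le> 1 / (1 - ?q) * N" for k
    proof -
      have "L2_set (\<lambda>n. cmod (\<Sum>i<k. it i n)) F \<le> L2_set (\<lambda>n. \<Sum>i<k. cmod (it i n)) F"
        by (intro L2_set_mono norm_sum) auto
      also have "\<dots> \<le> (\<Sum>i<k. L2_set (\<lambda>n. cmod (it i n)) F)"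
        by (rule L2_set_sum_le) simp
      also have "\<dots> \<le> (\<Sum>i<k. ?q ^ i * N)"
        by (intro sum_mono L2 F)
      also have "\<dots> \<le> (\<Sum>i. ?q ^ i * N)"
        using geo rate by (intro sum_le_suminf) (auto simp: N_def sums_iff intro!: infsum_nonneg mult_nonneg_nonneg)
      finally show ?thesis using geo by (simp add: sums_iff)
    qed
    ultimately have "L2_set (\<lambda>n. cmod (\<psi> n)) F \<le> 1 / (1 - ?q) * N"
      by (intro LIMSEQ_le_const2) auto
    then have "(L2_set (\<lambda>n. cmod (\<psi> n)) F)\<^sup>2 \<le> (1 / (1 - ?q) * N)\<^sup>2"
      by (intro power_mono) auto
    then show "(\<Sum>n\<in>F. (cmod (\<psi> n))\<^sup>2) \<le> (1 / (1 - ?q) * N)\<^sup>2"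
      by (simp add: L2_set_def sum_nonneg)
  qed
  moreover have "jac D \<psi> n = \<phi> n" for n
  proof -
    have S: "(\<lambda>i. it i k) sums \<psi> k" for k
      unfolding \<psi>_def using summ by (rule summable_sums)
    \<comment> \<open>\<open>relax\<close> sees only three sites, so it commutes with the pointwise
      series; applying it drops the first term \<open>it 0 = b\<close>.\<close>
    have "(\<lambda>i. relax (it i) n) sums relax \<psi> n"
      unfolding relax_def jac_def lap_def
      by (intro sums_diff sums_mult sums_add S)
    moreover have "(\<lambda>i. it (Suc i) n) sums (\<psi> n - it 0 n)"
      using S[of n] sums_Suc_iff[of "\<lambda>i. it i n" "\<psi> n - it 0 n"] by simp
    ultimately have "relax \<psi> n = \<psi> n - b n"
      unfolding it_def by (auto intro: sums_unique2)
    then have "of_real tau * cnj (s n) * jac D \<psi> n = of_real tau * cnj (s n) * \<phi> n"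
      unfolding relax_def b_def by simp
    moreover have "of_real tau * cnj (s n) \<noteq> 0"
      using tau_pos cmod_s[of n] by auto
    ultimately show ?thesis by (metis mult_cancel_left)
  qed
  ultimately show ?thesis by blast
qed

text \<open>For injectivity, a kernel element is fixed by \<open>relax\<close>, and a contraction
  factor below 1 forces its norm to vanish.\<close>

lemma bij_jac: "bij_betw (jac D) l2Z l2Z"
proof (rule bij_betw_imageI)
  show "inj_on (jac D) l2Z"
  proof (rule inj_onI)
    fix \<psi> \<eta> assume *: "\<psi> \<in> l2Z" "\<eta> \<in> l2Z" "jac D \<psi> = jac D \<eta>"
    define \<delta> where "\<delta> = (\<lambda>n. \<psi> n - \<eta> n)"
    have \<delta>: "\<delta> \<in> l2Z" unfolding \<delta>_def using * l2Z_diff by blast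
    have "jac D \<delta> n = 0" for n
      using fun_cong[OF *(3), of n] unfolding \<delta>_def jac_def lap_def by (simp add: algebra_simps)
    then have "relax \<delta> = \<delta>" unfolding relax_def by auto
    then have "(\<Sum>\<^sub>\<infinity>n. (cmod (\<delta> n))\<^sup>2) \<le> rate * (\<Sum>\<^sub>\<infinity>n. (cmod (\<delta> n))\<^sup>2)"
      using relax_contraction[OF \<delta>] by simp
    then have "(1 - rate) * (\<Sum>\<^sub>\<infinity>n. (cmod (\<delta> n))\<^sup>2) \<le> 0" by (simp add: algebra_simps)
    then have "(\<Sum>\<^sub>\<infinity>n. (cmod (\<delta> n))\<^sup>2) \<le> 0"
      using rate by (simp add: mult_le_0_iff)
    then have "sqrt (\<Sum>\<^sub>\<infinity>n. (cmod (\<delta> n))\<^sup>2) \<le> 0" by simp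
    then have "cmod (\<delta> n) \<le> 0" for n
      using l2Z_cmod_le[OF \<delta>, of n] by linarith
    then have "\<delta> n = 0" for n by simp
    then show "\<psi> = \<eta>" unfolding \<delta>_def by auto
  qed
  show "jac D ` l2Z = l2Z"
  proof (intro equalityI subsetI)
    show "\<phi> \<in> l2Z" if "\<phi> \<in> jac D ` l2Z" for \<phi>
      using that jac_in_l2Z[OF D_bounded] by auto
    show "\<phi> \<in> jac D ` l2Z" if "\<phi> \<in> l2Z" for \<phi>
      using surj_jac[OF that] by auto
  qed
qed

end

section \<open>Spectral bands\<close>

lemma op_spectrum_jac:
  "z \<in> op_spectrum V \<longleftrightarrow> \<not> bij_betw (jac (\<lambda>n. complex_of_real (V n) - z)) l2Z l2Z"
  unfolding op_spectrum_def schr_minus_eq_jac by simp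

text \<open>The Floquet condition: the transfer matrix over one period has trace
  \<open>(\<alpha> - E) * (\<beta> - E) - 2\<close>, and the bounds say that this trace lies between
  -2 and 2.\<close>

definition band :: "real \<Rightarrow> real \<Rightarrow> complex set" where
  "band \<alpha> \<beta> = complex_of_real ` {E. 0 \<le> (\<alpha> - E) * (\<beta> - E) \<and> (\<alpha> - E) * (\<beta> - E) \<le> 4}"

lemma band_commute: "band \<alpha> \<beta> = band \<beta> \<alpha>"
  unfolding band_def by (simp add: mult.commute)

text \<open>With the constant multiplier \<open>- \<i> * sgn (Im z)\<close> every hopping term
  cancels and the real part of the diagonal is \<open>\<bar>Im z\<bar>\<close>, so all shares can be
  0.\<close>

lemma op_spectrum_real:
  assumes V: "\<And>n. \<bar>V n\<bar> \<le> B" and z: "z \<in> op_spectrum V"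
  shows "Im z = 0"
proof (rule ccontr)
  assume nz: "Im z \<noteq> 0"
  interpret coercive_jac "\<lambda>n. complex_of_real (V n) - z" "\<lambda>_. - \<i> * of_real (sgn (Im z))"
    "\<lambda>_. 0" "\<bar>Im z\<bar>" "B + cmod z"
  proof
    show "cmod (complex_of_real (V n) - z) \<le> B + cmod z" for n
      using norm_triangle_ineq4[of "complex_of_real (V n)" z] V[of n] by simp
    show "cmod (- \<i> * of_real (sgn (Im z))) = 1" for n :: int
      using nz by (simp add: norm_mult sgn_real_def)
  qed (use nz in \<open>auto simp: sgn_real_def abs_if\<close>)
  show False using bij_jac z op_spectrum_jac by blast
qed

text \<open>The parameter \<open>t\<close> balances the two sublattices in
  \<open>2 |x y| \<le> t |x|\<^sup>2 + |y|\<^sup>2 / t\<close>.\<close>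
lemma balancing_parameter:
  fixes P Q :: "real set"
  assumes "finite P" "finite Q" and P: "\<And>p. p \<in> P \<Longrightarrow> 0 < p" and Q: "\<And>q. q \<in> Q \<Longrightarrow> 0 < q"
    and PQ: "\<And>p q. p \<in> P \<Longrightarrow> q \<in> Q \<Longrightarrow> 4 < p * q"
  shows "\<exists>t>0. \<exists>c>0. (\<forall>p\<in>P. 2 * t + c \<le> p) \<and> (\<forall>q\<in>Q. 2 / t + c \<le> q)"
proof -
  have "\<exists>p0>0. \<exists>q0>0. 4 < p0 * q0 \<and> (\<forall>p\<in>P. p0 \<le> p) \<and> (\<forall>q\<in>Q. q0 \<le> q)"
  proof (cases "P = {} \<or> Q = {}")
    case False
    then have "Min P \<in> P" "Min Q \<in> Q" using assms by auto
    then show ?thesis using assms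
      by (intro exI[of _ "Min P"] exI[of _ "Min Q"] conjI) auto
  next
    case True
    \<comment> \<open>With one set empty its bound is free: \<open>m\<close> bounds the other set
      from below and \<open>5 / m\<close> makes the product 5. Inserting 1 covers the case that both
      are empty.\<close>
    define m where "m = Min (insert 1 (P \<union> Q))"
    have "m \<in> insert 1 (P \<union> Q)" unfolding m_def using assms by (intro Min_in) auto
    then have m: "0 < m" using P Q by auto
    have le: "\<forall>p\<in>P. m \<le> p" "\<forall>q\<in>Q. m \<le> q" unfolding m_def using assms by auto
    show ?thesis
    proof (cases "P = {}")
      case True
      then show ?thesis using m le by (intro exI[of _ "5 / m"] conjI exI[of _ m]) auto
    next
      case False
      then have "Q = {}" using \<open>P = {} \<or> Q = {}\<close> by blast
      then show ?thesis using m le by (intro exI[of _ m] conjI exI[of _ "5 / m"]) auto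
    qed
  qed
  then obtain p0 q0 where pq: "0 < p0" "0 < q0" "4 < p0 * q0"
    and le: "\<forall>p\<in>P. p0 \<le> p" "\<forall>q\<in>Q. q0 \<le> q" by blast
  \<comment> \<open>A product above 4 says exactly that there is room for \<open>t\<close> between
    these two numbers.\<close>
  have "2 / q0 < p0 / 2" using pq by (simp add: field_simps)
  then obtain t where t: "2 / q0 < t" "t < p0 / 2" using dense by blast
  have t0: "0 < t" using t pq by (meson divide_pos_pos less_trans zero_less_numeral)
  have "2 / t < q0" using t(1) t0 pq by (simp add: field_simps)
  then have "0 < min (p0 - 2 * t) (q0 - 2 / t)" using t by simp
  moreover have "\<forall>p\<in>P. 2 * t + min (p0 - 2 * t) (q0 - 2 / t) \<le> p"
    "\<forall>q\<in>Q. 2 / t + min (p0 - 2 * t) (q0 - 2 / t) \<le> q"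
    using le by (auto simp: min_def)
  ultimately show ?thesis using t0 by blast
qed

text \<open>Neighbouring sites draw from different sets, so a bond between equal signs joins a value
  of \<open>A\<close> to a value of \<open>B\<close> on the same side of \<open>E\<close>. Off the
  bands their distances to \<open>E\<close> have product above 4, which is what
  \<open>balancing_parameter\<close> asks for.\<close>

lemma op_spectrum_subset_bands:
  assumes fin: "finite A" "finite B"
    and V: "\<And>n. V n \<in> (if even n then A else B)"
  shows "op_spectrum V \<subseteq> (\<Union>\<alpha>\<in>A. \<Union>\<beta>\<in>B. band \<alpha> \<beta>)"
proof
  fix z assume z: "z \<in> op_spectrum V"
  have "bounded (A \<union> B)" using fin by (simp add: finite_imp_bounded)
  then obtain M where M: "\<And>v. v \<in> A \<union> B \<Longrightarrow> \<bar>v\<bar> \<le> M" by (auto simp: bounded_iff)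
  have VM: "\<bar>V n\<bar> \<le> M" for n using V[of n] M by (auto split: if_splits)
  define E where "E = Re z"
  have zE: "z = of_real E"
    using op_spectrum_real[OF VM z] by (simp add: E_def complex_eq_iff)
  show "z \<in> (\<Union>\<alpha>\<in>A. \<Union>\<beta>\<in>B. band \<alpha> \<beta>)"
  proof (rule ccontr)
    assume "z \<notin> (\<Union>\<alpha>\<in>A. \<Union>\<beta>\<in>B. band \<alpha> \<beta>)"
    then have gap: "(\<alpha> - E) * (\<beta> - E) < 0 \<or> 4 < (\<alpha> - E) * (\<beta> - E)" if "\<alpha> \<in> A" "\<beta> \<in> B" for \<alpha> \<beta>
      using that unfolding zE band_def by (auto simp: not_le image_iff)
    \<comment> \<open>A value equal to \<open>E\<close> would give the product 0, which belongs to a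
      band.\<close>
    have nz: "V n \<noteq> E" for n
      using gap[of "V n" "V (n + 1)"] gap[of "V (n + 1)" "V n"] V[of n] V[of "n + 1"]
      by (auto split: if_splits)
    \<comment> \<open>Distances to \<open>E\<close> of the values above it
      (\<open>\<sigma> = 1\<close>) or below it (\<open>\<sigma> = -1\<close>).\<close>
    define pos where "pos = (\<lambda>\<sigma> S. {\<sigma> * (v - E) | v. v \<in> S \<and> 0 < \<sigma> * (v - E)})"
    have ex: "\<exists>t>0. \<exists>c>0. (\<forall>p\<in>pos \<sigma> A. 2 * t + c \<le> p) \<and> (\<forall>q\<in>pos \<sigma> B. 2 / t + c \<le> q)"
      if \<sigma>: "\<sigma> = 1 \<or> \<sigma> = -1" for \<sigma> :: real
    proof (rule balancing_parameter)
      show "finite (pos \<sigma> A)" "finite (pos \<sigma> B)"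
        using fin unfolding pos_def by (auto simp: setcompr_eq_image)
      show "4 < p * q" if "p \<in> pos \<sigma> A" "q \<in> pos \<sigma> B" for p q
      proof -
        from that obtain v w where vw: "v \<in> A" "w \<in> B" "p = \<sigma> * (v - E)" "q = \<sigma> * (w - E)" "0 < p" "0 < q"
          unfolding pos_def by blast
        have "p * q = \<sigma> * \<sigma> * ((v - E) * (w - E))" unfolding vw(3,4) by (simp only: ac_simps)
        then have "p * q = (v - E) * (w - E)" using \<sigma> by auto
        moreover have "0 < p * q" using vw by simp
        ultimately show ?thesis using gap[OF vw(1,2)] by simp
      qed
    qed (auto simp: pos_def)
    obtain t1 c1 where 1: "0 < t1" "0 < c1" "\<forall>p\<in>pos 1 A. 2 * t1 + c1 \<le> p" "\<forall>q\<in>pos 1 B. 2 / t1 + c1 \<le> q"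
      using ex[of 1] by auto
    obtain t2 c2 where 2: "0 < t2" "0 < c2" "\<forall>p\<in>pos (-1) A. 2 * t2 + c2 \<le> p" "\<forall>q\<in>pos (-1) B. 2 / t2 + c2 \<le> q"
      using ex[of "-1"] by auto
    \<comment> \<open>Each side of \<open>E\<close> has its own parameter. Both ends of an
      equal-sign bond carry the same one, and their shares \<open>t\<close> and \<open>1 / t\<close>
      multiply to 1.\<close>
    define t where "t = (\<lambda>n. if E < V n then t1 else t2)"
    interpret coercive_jac "\<lambda>n. complex_of_real (V n) - z" "\<lambda>n. of_real (sgn (V n - E))"
      "\<lambda>n. if even n then t n else 1 / t n" "min c1 c2" "M + cmod z"
    proof
      show "0 < min c1 c2" using 1 2 by simp
      show "cmod (complex_of_real (V n) - z) \<le> M + cmod z" for n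
        using norm_triangle_ineq4[of "complex_of_real (V n)" z] VM[of n] by simp
      show "cmod (of_real (sgn (V n - E))) = 1" for n
        using nz[of n] by (simp add: sgn_real_def)
      show "0 \<le> (if even n then t n else 1 / t n)" for n
        using 1 2 by (auto simp: t_def)
      show "2 * (if even n then t n else 1 / t n) + min c1 c2
          \<le> Re (cnj (of_real (sgn (V n - E))) * (complex_of_real (V n) - z))" for n
      proof -
        have Re: "Re (cnj (of_real (sgn (V n - E))) * (complex_of_real (V n) - z)) = \<bar>V n - E\<bar>"
          by (simp add: zE sgn_real_def)
        show ?thesis
        proof (cases "E < V n")
          case True
          then have "\<bar>V n - E\<bar> \<in> pos 1 (if even n then A else B)"
            unfolding pos_def using V[of n] by auto
          then show ?thesis unfolding Re t_def using True 1(3,4)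
            by (cases "even n") force+
        next
          case False
          then have "\<bar>V n - E\<bar> \<in> pos (-1) (if even n then A else B)"
            unfolding pos_def using V[of n] nz[of n] by auto
          then show ?thesis unfolding Re t_def using False 2(3,4)
            by (cases "even n") force+
        qed
      qed
      show "cnj (of_real (sgn (V n - E))) + of_real (sgn (V (n + 1) - E)) = (0::complex) \<or>
         1 \<le> (if even n then t n else 1 / t n) * (if even (n + 1) then t (n + 1) else 1 / t (n + 1))" for n
        using 1(1) 2(1) nz[of n] nz[of "n + 1"] by (auto simp: t_def sgn_real_def)
    qed
    show False using bij_jac z op_spectrum_jac by blast
  qed
qed

text \<open>A Floquet solution: alternating amplitudes times powers of a unit number
  \<open>\<zeta>\<close> with \<open>\<zeta> + inverse \<zeta> = sqrt (p * q)\<close>, which exists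
  because this root lies between 0 and 2.\<close>

lemma bounded_periodic_solution:
  fixes p q :: real
  assumes "0 \<le> p * q" "p * q \<le> 4"
  obtains u :: "int \<Rightarrow> complex" and C0 C1 :: real where
    "\<And>n. u (n + 1) + u (n - 1) + of_real (if even n then p else q) * u n = 0"
    "\<And>n. (cmod (u n))\<^sup>2 = (if even n then C0 else C1)" "0 < C0 + C1"
proof -
  define x where "x = sqrt (p * q)"
  define y where "y = sqrt (1 - (x / 2)\<^sup>2)"
  define \<zeta> where "\<zeta> = Complex (x / 2) y"
  have xx: "x * x = p * q" using assms by (simp add: x_def)
  then have "(x / 2)\<^sup>2 \<le> 1" using assms by (simp add: power2_eq_square)
  then have yy: "(x / 2)\<^sup>2 + y\<^sup>2 = 1" by (simp add: y_def)
  have nz: "cmod \<zeta> = 1" using yy by (simp add: \<zeta>_def cmod_def)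
  then have \<zeta>0: "\<zeta> \<noteq> 0" by auto
  have inv: "inverse \<zeta> = cnj \<zeta>" using yy by (simp add: \<zeta>_def complex_eq_iff)
  have sum: "\<zeta> + inverse \<zeta> = of_real x" unfolding inv by (simp add: \<zeta>_def complex_eq_iff)
  \<comment> \<open>The amplitudes span the kernel of the singular matrix with rows
    \<open>(p, x)\<close> and \<open>(x, q)\<close>. The vector \<open>(q, - x)\<close> serves
    unless \<open>q = 0\<close>; then \<open>x = 0\<close> and \<open>(0, 1)\<close> does.\<close>
  define a0 where "a0 = (if q = 0 then 0 else q)"
  define a1 where "a1 = (if q = 0 then 1 else - x)"
  have a: "a1 * x + p * a0 = 0" "a0 * x + q * a1 = 0" "0 < a0\<^sup>2 + a1\<^sup>2"
    using xx by (auto simp: a0_def a1_def x_def sum_power2_gt_zero_iff)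
  define u where "u = (\<lambda>n::int. of_real (if even n then a0 else a1) * \<zeta> powi n)"
  show ?thesis
  proof (rule that[of u "a0\<^sup>2" "a1\<^sup>2"])
    show "u (n + 1) + u (n - 1) + of_real (if even n then p else q) * u n = 0" for n
    proof -
      have *: "\<zeta> powi (n + 1) = \<zeta> powi n * \<zeta>" "\<zeta> powi (n - 1) = \<zeta> powi n * inverse \<zeta>"
        using \<zeta>0 by (simp_all add: power_int_add power_int_diff divide_inverse)
      have "u (n + 1) + u (n - 1) + of_real (if even n then p else q) * u n
        = \<zeta> powi n * (of_real (if even n then a1 else a0) * (\<zeta> + inverse \<zeta>)
           + of_real (if even n then p else q) * of_real (if even n then a0 else a1))"
        unfolding u_def * by (simp add: algebra_simps)
      also have "\<dots> = \<zeta> powi n * of_real (if even n then a1 * x + p * a0 else a0 * x + q * a1)"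
        unfolding sum by simp
      finally show ?thesis using a by simp
    qed
    show "(cmod (u n))\<^sup>2 = (if even n then a0\<^sup>2 else a1\<^sup>2)" for n
      by (simp add: u_def norm_mult norm_power_int nz)
    show "0 < a0\<^sup>2 + a1\<^sup>2" by (rule a)
  qed
qed

text \<open>Discrete Green identity: testing against a formal solution leaves only Wronskians.\<close>
lemma green_jac:
  fixes u \<psi> D :: "int \<Rightarrow> complex" and d :: "int \<Rightarrow> real"
  assumes u: "\<And>n. u (n + 1) + u (n - 1) + of_real (d n) * u n = 0"
    and D: "\<And>i. i < N \<Longrightarrow> D (s + int i) = of_real (d (int i))"
  defines "W \<equiv> \<lambda>i. cnj (u (int i - 1)) * \<psi> (s + int i) - cnj (u (int i)) * \<psi> (s + int i - 1)"
  shows "(\<Sum>i<N. cnj (u (int i)) * jac D \<psi> (s + int i)) = W N - W 0"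
proof -
  have "cnj (u (int i)) * jac D \<psi> (s + int i) = W (Suc i) - W i" if "i < N" for i
  proof -
    have "cnj (u (int i + 1)) + cnj (u (int i - 1)) + of_real (d (int i)) * cnj (u (int i)) = 0"
      using arg_cong[OF u[of "int i"], of cnj] by simp
    then have *: "of_real (d (int i)) * cnj (u (int i)) = - cnj (u (int i + 1)) - cnj (u (int i - 1))"
      by (metis add.commute add_diff_cancel_right' diff_0 diff_diff_eq)
    have "cnj (u (int i)) * jac D \<psi> (s + int i)
      = cnj (u (int i)) * \<psi> (s + int i + 1) + cnj (u (int i)) * \<psi> (s + int i - 1)
        + (of_real (d (int i)) * cnj (u (int i))) * \<psi> (s + int i)"
      using D[OF that] unfolding jac_def lap_def by (simp add: algebra_simps)
    also have "\<dots> = W (Suc i) - W i"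
      unfolding * W_def by (simp add: algebra_simps)
    finally show ?thesis .
  qed
  then show ?thesis by (simp add: sum_lessThan_telescope)
qed

lemma sum_alternating:
  fixes C0 C1 :: real
  shows "(\<Sum>i<2 * L. if even i then C0 else C1) = real L * (C0 + C1)"
  by (induction L) (auto simp: algebra_simps)

lemma sum_int_interval:
  fixes f :: "int \<Rightarrow> 'a::comm_monoid_add"
  shows "(\<Sum>n\<in>{s..<s + int N}. f n) = (\<Sum>i<N. f (s + int i))"
  by (rule sum.reindex_bij_witness[of _ "\<lambda>i. s + int i" "\<lambda>n. nat (n - s)"]) auto

text \<open>Parity is counted from the start of the block, so the site \<open>s\<close> may be even
  or odd. Blocks beyond every \<open>N\<close> allow disjoint ones to be picked in
  succession.\<close>

definition has_blocks :: "(int \<Rightarrow> real) \<Rightarrow> real \<Rightarrow> real \<Rightarrow> bool" where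
  "has_blocks V \<alpha> \<beta> \<longleftrightarrow>
    (\<forall>L::nat. \<forall>N::int. \<exists>s>N. \<forall>i<2 * L. V (s + int i) = (if even i then \<alpha> else \<beta>))"

text \<open>Pairing \<open>\<phi>\<close> with the periodic solution over the \<open>k\<close>-th block gives \<open>2\<^sup>k (C0 + C1)\<close>, whereas by
  Green's identity the same pairing with the image of any \<open>\<psi>\<close> in \<open>\<ell>\<^sup>2\<close> stays bounded in \<open>k\<close>.\<close>
lemma band_subset_op_spectrum:
  assumes blocks: "has_blocks V \<alpha> \<beta>"
  shows "band \<alpha> \<beta> \<subseteq> op_spectrum V"
proof
  fix z assume "z \<in> band \<alpha> \<beta>"
  then obtain E where zE: "z = of_real E" and E: "0 \<le> (\<alpha> - E) * (\<beta> - E)" "(\<alpha> - E) * (\<beta> - E) \<le> 4"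
    unfolding band_def by auto
  define D where "D = (\<lambda>n. complex_of_real (V n) - z)"
  obtain u :: "int \<Rightarrow> complex" and C0 C1 where
    u: "\<And>n. u (n + 1) + u (n - 1) + of_real (if even n then \<alpha> - E else \<beta> - E) * u n = 0"
    and cmod_u: "\<And>n. (cmod (u n))\<^sup>2 = (if even n then C0 else C1)" and C: "0 < C0 + C1"
    using bounded_periodic_solution[OF E] by blast
  define Bu where "Bu = sqrt (max C0 C1)"
  have u_le: "cmod (u n) \<le> Bu" for n
    unfolding Bu_def using cmod_u[of n] by (intro real_le_rsqrt) auto
  have Bu0: "0 \<le> Bu" using u_le[of 0] norm_ge_zero order_trans by blast
  \<comment> \<open>Length \<open>2 * 8 ^ k\<close> goes with the weight \<open>(1 / 4) ^ k\<close>
    below: the mass of a block is of order \<open>8 ^ k / 16 ^ k\<close>, hence summable, while its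
    pairing is of order \<open>8 ^ k / 4 ^ k\<close>, hence unbounded.\<close>
  define len :: "nat \<Rightarrow> nat" where "len = (\<lambda>k. 2 * 8 ^ k)"
  define good where "good = (\<lambda>k s. \<forall>i<len k. V (s + int i) = (if even i then \<alpha> else \<beta>))"
  have ex: "\<exists>s>N. good k s" for k and N
    using blocks unfolding has_blocks_def good_def len_def by blast
  define nxt where "nxt = (\<lambda>k N. SOME s. N < s \<and> good k s)"
  have nxt: "N < nxt k N \<and> good k (nxt k N)" for k N
    unfolding nxt_def by (rule someI_ex[OF ex])
  \<comment> \<open>Each block starts beyond the end of the previous one.\<close>
  define st where "st = rec_nat (nxt 0 0) (\<lambda>k s. nxt (Suc k) (s + int (len k)))"
  have good: "good k (st k)" for k
    by (cases k) (use nxt in \<open>simp_all add: st_def\<close>)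
  have step: "st k + int (len k) < st (Suc k)" for k
    using nxt by (simp add: st_def)
  have st_mono: "st k + int (len k) \<le> st l" if "k < l" for k l
    using that
  proof (induction l rule: less_induct)
    case (less l)
    then obtain l' where l: "l = Suc l'" by (cases l) auto
    show ?case
    proof (cases "k = l'")
      case True then show ?thesis using step[of k] l by simp
    next
      case False
      then have "st k + int (len k) \<le> st l'" using less l by simp
      then show ?thesis using step[of l'] l by simp
    qed
  qed
  define I where "I = (\<lambda>k. {st k..<st k + int (len k)})"
  have disj: "k = l" if "n \<in> I k" "n \<in> I l" for n k l
    using that st_mono[of k l] st_mono[of l k] unfolding I_def by (cases k l rule: linorder_cases) auto
  have finite_I: "finite (I k)" for k unfolding I_def by simp
  define w :: "nat \<Rightarrow> real" where "w = (\<lambda>k. (1 / 4) ^ k)"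
  define \<phi> where "\<phi> = (\<lambda>n. if \<exists>k. n \<in> I k then
      (let k = THE k. n \<in> I k in of_real (w k) * u (n - st k)) else 0)"
  have \<phi>: "\<phi> n = of_real (w k) * u (n - st k)" if "n \<in> I k" for n k
  proof -
    have "(THE k. n \<in> I k) = k" using that disj by (intro the_equality) auto
    then show ?thesis using that unfolding \<phi>_def by auto
  qed
  have block_mass: "(\<Sum>n\<in>I k. (cmod (\<phi> n))\<^sup>2) = (1 / 2) ^ k * (C0 + C1)" for k
  proof -
    have "(\<Sum>n\<in>I k. (cmod (\<phi> n))\<^sup>2) = (\<Sum>n\<in>I k. (w k)\<^sup>2 * (cmod (u (n - st k)))\<^sup>2)"
      by (intro sum.cong refl) (simp add: \<phi> norm_mult power_mult_distrib)
    also have "\<dots> = (\<Sum>i<len k. (w k)\<^sup>2 * (if even i then C0 else C1))"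
      unfolding I_def sum_int_interval by (simp add: cmod_u)
    also have "\<dots> = (w k)\<^sup>2 * (8 ^ k * (C0 + C1))"
      unfolding sum_distrib_left[symmetric] len_def sum_alternating by simp
    also have "(w k)\<^sup>2 * 8 ^ k = (1 / 2) ^ k"
      unfolding w_def power2_eq_square power_mult_distrib[symmetric] by simp
    then have "(w k)\<^sup>2 * (8 ^ k * (C0 + C1)) = (1 / 2) ^ k * (C0 + C1)" by (simp add: mult.assoc[symmetric])
    finally show ?thesis .
  qed
  have "\<phi> \<in> l2Z"
  proof (rule l2Z_bounded_sumsI)
    fix F :: "int set" assume F: "finite F"
    \<comment> \<open>Block index of a site. Outside all blocks the value is arbitrary, which is
      harmless: \<open>\<phi>\<close> vanishes there, and an extra index in \<open>J\<close> only
      enlarges the bound.\<close>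
    define \<kappa> where "\<kappa> = (\<lambda>n. THE k. n \<in> I k)"
    define J where "J = \<kappa> ` F"
    have fin: "finite J" using F by (simp add: J_def)
    have \<kappa>: "\<kappa> n = k" if "n \<in> I k" for n k
      unfolding \<kappa>_def using that disj by (intro the_equality) auto
    have "(\<Sum>n\<in>F. (cmod (\<phi> n))\<^sup>2) = (\<Sum>n\<in>F \<inter> (\<Union>k\<in>J. I k). (cmod (\<phi> n))\<^sup>2)"
    proof (intro sum.mono_neutral_right F ballI)
      fix n assume "n \<in> F - F \<inter> (\<Union>k\<in>J. I k)"
      then have "\<nexists>k. n \<in> I k" using \<kappa> by (auto simp: J_def)
      then show "(cmod (\<phi> n))\<^sup>2 = 0" by (simp add: \<phi>_def)
    qed simp
    also have "\<dots> \<le> (\<Sum>n\<in>(\<Union>k\<in>J. I k). (cmod (\<phi> n))\<^sup>2)"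
      using fin finite_I by (intro sum_mono2) auto
    also have "\<dots> = (\<Sum>k\<in>J. \<Sum>n\<in>I k. (cmod (\<phi> n))\<^sup>2)"
      using fin finite_I disj by (intro sum.UNION_disjoint) blast+
    also have "\<dots> = (\<Sum>k\<in>J. (1 / 2) ^ k) * (C0 + C1)"
      unfolding block_mass sum_distrib_right ..
    also have "(\<Sum>k\<in>J. (1 / 2) ^ k) \<le> (\<Sum>k. (1 / 2 :: real) ^ k)"
      using fin by (intro sum_le_suminf) auto
    then have "(\<Sum>k\<in>J. (1 / 2) ^ k) * (C0 + C1) \<le> (\<Sum>k. (1 / 2 :: real) ^ k) * (C0 + C1)"
      using C by (intro mult_right_mono) auto
    finally show "(\<Sum>n\<in>F. (cmod (\<phi> n))\<^sup>2) \<le> (\<Sum>k. (1 / 2 :: real) ^ k) * (C0 + C1)" .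
  qed
  have "\<phi> \<notin> jac D ` l2Z"
  proof
    assume "\<phi> \<in> jac D ` l2Z"
    then obtain \<psi> where \<psi>: "\<psi> \<in> l2Z" "jac D \<psi> = \<phi>" by auto
    define B where "B = sqrt (\<Sum>\<^sub>\<infinity>n. (cmod (\<psi> n))\<^sup>2)"
    have B: "cmod (\<psi> n) \<le> B" for n unfolding B_def by (rule l2Z_cmod_le[OF \<psi>(1)])
    have bound: "2 ^ k * (C0 + C1) \<le> 4 * (Bu * B)" for k
    proof -
      define W where "W = (\<lambda>i. cnj (u (int i - 1)) * \<psi> (st k + int i) - cnj (u (int i)) * \<psi> (st k + int i - 1))"
      have W: "cmod (W i) \<le> 2 * (Bu * B)" for i
      proof -
        have "cmod (cnj (u m) * \<psi> n) \<le> Bu * B" for m n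
          unfolding norm_mult complex_mod_cnj using u_le B Bu0 by (intro mult_mono) auto
        then show ?thesis
          unfolding W_def using norm_triangle_le_diff by (metis add_mono mult_2)
      qed
      have Dk: "D (st k + int i) = of_real (if even (int i) then \<alpha> - E else \<beta> - E)" if "i < len k" for i
        using good[of k] that unfolding good_def D_def zE by auto
      have "(\<Sum>i<len k. cnj (u (int i)) * jac D \<psi> (st k + int i)) = W (len k) - W 0"
        unfolding W_def by (rule green_jac[OF u Dk])
      moreover have "cnj (u (int i)) * jac D \<psi> (st k + int i)
          = of_real (w k * (if even i then C0 else C1))" if "i < len k" for i
      proof -
        have "cnj (u (int i)) * u (int i) = of_real (if even i then C0 else C1)"
          using cmod_u[of "int i"] complex_norm_square[of "u (int i)"] by (simp add: mult.commute)
        then show ?thesis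
          using \<phi>[of "st k + int i" k] that unfolding \<psi>(2) I_def by (simp add: mult.left_commute)
      qed
      ultimately have "complex_of_real (\<Sum>i<len k. w k * (if even i then C0 else C1)) = W (len k) - W 0"
        by simp
      moreover have "(\<Sum>i<len k. w k * (if even i then C0 else C1)) = 2 ^ k * (C0 + C1)"
      proof -
        have "w k * 8 ^ k = 2 ^ k" unfolding w_def power_mult_distrib[symmetric] by simp
        then show ?thesis
          unfolding sum_distrib_left[symmetric] len_def sum_alternating by (simp add: mult.assoc[symmetric])
      qed
      ultimately have "2 ^ k * (C0 + C1) = cmod (W (len k) - W 0)"
        using C by (metis norm_of_real abs_of_nonneg less_imp_le mult_nonneg_nonneg zero_le_numeral zero_le_power)
      also have "\<dots> \<le> cmod (W (len k)) + cmod (W 0)" by (rule norm_triangle_ineq4)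
      finally show ?thesis using W[of "len k"] W[of 0] by linarith
    qed
    obtain k where "4 * (Bu * B) / (C0 + C1) < 2 ^ k"
      using real_arch_pow[of 2] by auto
    then show False using bound[of k] C by (simp add: divide_less_eq)
  qed
  then show "z \<in> op_spectrum V"
    unfolding op_spectrum_jac D_def[symmetric] bij_betw_def using \<open>\<phi> \<in> l2Z\<close> by auto
qed

section \<open>Potentials along orbits of the product system\<close>

lemma Tpow_eq:
  assumes "j < 2"
  shows "Tpow n (x, j) = (\<lambda>k. x (k + n), (j + nat \<bar>n\<bar>) mod 2)"
proof -
  have 1: "(T ^^ k) (x, j) = (\<lambda>i. x (i + int k), (j + k) mod 2)" for k
    using assms by (induction k) (auto simp: T_def shift_def fun_eq_iff algebra_simps mod_simps)
  have 2: "(T_inv ^^ k) (x, j) = (\<lambda>i. x (i - int k), (j + k) mod 2)" for k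
    using assms by (induction k) (auto simp: T_inv_def shift_inv_def fun_eq_iff algebra_simps mod_simps)
  show ?thesis unfolding Tpow_def by (auto simp: 1 2)
qed

lemma pot_eq:
  assumes "j < 2"
  shows "pot g (x, j) n = g (x n) (if even n \<longleftrightarrow> j = 0 then 0 else 1)"
proof -
  have "(j + nat \<bar>n\<bar>) mod 2 = (if even n \<longleftrightarrow> j = 0 then 0 else 1)"
    using assms by (cases "even n") (auto simp: less_2_cases_iff even_nat_iff mod2_eq_if)
  then show ?thesis by (simp add: pot_def Tpow_eq[OF assms])
qed

text \<open>Both inclusions are instances of the general ones: the values on each sublattice form a
  singleton, and the periodic potential has its own block at every even site.\<close>

lemma op_spectrum_omega_ab:
  "op_spectrum (pot g (omega_ab a b)) = band (g a 0) (g b 1)"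
proof -
  have V: "pot g (omega_ab a b) n = (if even n then g a 0 else g b 1)" for n
    unfolding omega_ab_def by (simp add: pot_eq)
  have "has_blocks (pot g (omega_ab a b)) (g a 0) (g b 1)"
    unfolding has_blocks_def
  proof (intro allI)
    fix L :: nat and N :: int
    show "\<exists>s>N. \<forall>i<2 * L. pot g (omega_ab a b) (s + int i) = (if even i then g a 0 else g b 1)"
      by (rule exI[of _ "2 * (\<bar>N\<bar> + 1)"]) (auto simp: V)
  qed
  then have "band (g a 0) (g b 1) \<subseteq> op_spectrum (pot g (omega_ab a b))"
    by (rule band_subset_op_spectrum)
  moreover have "op_spectrum (pot g (omega_ab a b)) \<subseteq> (\<Union>\<alpha>\<in>{g a 0}. \<Union>\<beta>\<in>{g b 1}. band \<alpha> \<beta>)"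
    by (rule op_spectrum_subset_bands) (auto simp: V)
  ultimately show ?thesis by auto
qed

text \<open>The coordinate \<open>j = 1\<close> swaps the two sublattices, and bands are symmetric
  in their parameters.\<close>

lemma op_spectrum_pot_subset:
  assumes \<omega>: "\<omega> \<in> XZ2 m"
  shows "op_spectrum (pot g \<omega>) \<subseteq> (\<Union>a\<in>{1..m}. \<Union>b\<in>{1..m}. band (g a 0) (g b 1))"
proof -
  obtain x j where xj: "\<omega> = (x, j)" "\<And>n. x n \<in> {1..m}" "j = 0 \<or> j = 1"
    using \<omega> unfolding XZ2_def by auto
  let ?A = "(\<lambda>a. g a 0) ` {1..m}" and ?B = "(\<lambda>a. g a 1) ` {1..m}"
  from xj(3) show ?thesis
  proof
    assume j: "j = 0"
    have "pot g \<omega> n \<in> (if even n then ?A else ?B)" for n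
      unfolding xj(1) j using xj(2)[of n] by (auto simp: pot_eq)
    from op_spectrum_subset_bands[OF _ _ this] show ?thesis by auto
  next
    assume j: "j = 1"
    have "pot g \<omega> n \<in> (if even n then ?B else ?A)" for n
      unfolding xj(1) j using xj(2)[of n] by (auto simp: pot_eq)
    from op_spectrum_subset_bands[OF _ _ this]
    have "op_spectrum (pot g \<omega>) \<subseteq> (\<Union>b\<in>{1..m}. \<Union>a\<in>{1..m}. band (g b 1) (g a 0))" by auto
    also have "\<dots> \<subseteq> (\<Union>a\<in>{1..m}. \<Union>b\<in>{1..m}. band (g a 0) (g b 1))"
      using band_commute by blast
    finally show ?thesis .
  qed
qed

section \<open>Occurrence of words\<close>

text \<open>The joint law of the coordinates is the product measure itself, hence the product of
  their marginals.\<close>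

lemma product_prob_space_indep_components:
  fixes M :: "'i \<Rightarrow> 'a measure"
  assumes "product_prob_space M"
  shows "prob_space.indep_vars (PiM UNIV M) M (\<lambda>i x. x i) UNIV"
proof -
  interpret product_prob_space M UNIV by fact
  have "distr (PiM UNIV M) (PiM UNIV M) (\<lambda>x. \<lambda>i\<in>UNIV. x i) = PiM UNIV M"
    unfolding restrict_UNIV by (rule distr_id)
  also have "\<dots> = PiM UNIV (\<lambda>i. distr (PiM UNIV M) (M i) (\<lambda>x. x i))"
    by (intro PiM_cong) (auto simp: PiM_component)
  finally show ?thesis
    by (subst P.indep_vars_iff_distr_eq_PiM) auto
qed

text \<open>Consecutive windows of length \<open>N\<close> from \<open>b\<close> on are disjoint, so
  missing the word in each of them are independent events of probability \<open>1 - q < 1\<close>.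
  Missing it in the first \<open>n\<close> windows has probability \<open>(1 - q) ^ n\<close>, which
  tends to 0.\<close>

lemma AE_word_occurs:
  fixes \<mu> :: "'a pmf" and w :: "nat \<Rightarrow> 'a" and b :: int
  assumes w: "\<And>i. i < N \<Longrightarrow> w i \<in> set_pmf \<mu>"
  shows "AE x in PiM UNIV (\<lambda>_::int. measure_pmf \<mu>). \<exists>k. \<forall>i<N. x (b + int (k * N + i)) = w i"
proof (cases "N = 0")
  case True then show ?thesis by simp
next
  case False
  define M where "M = PiM UNIV (\<lambda>_::int. measure_pmf \<mu>)"
  interpret product_prob_space "\<lambda>_::int. measure_pmf \<mu>" UNIV
    by unfold_locales
  interpret M: prob_space M unfolding M_def by unfold_locales
  define pos where "pos = (\<lambda>k i. b + int (k * N + i))"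
  define Q where "Q = (\<lambda>k (x :: int \<Rightarrow> 'a). \<forall>i<N. x (pos k i) = w i)"
  define K where "K = (\<lambda>k. pos k ` {..<N})"
  have inj: "inj_on (pos k) {..<N}" for k by (auto simp: inj_on_def pos_def)
  have disj: "disjoint_family_on K UNIV"
  proof -
    have "k = l" if "k * N + i = l * N + j" "i < N" "j < N" for k l i j :: nat
      using that by (metis add.commute div_mult_self1 div_less add_0 False mult.commute)
    then show ?thesis
      unfolding disjoint_family_on_def K_def pos_def by (auto simp del: of_nat_add of_nat_mult)
  qed
  have indep: "M.indep_vars (\<lambda>_. measure_pmf \<mu>) (\<lambda>i x. x i) UNIV"
    unfolding M_def by (rule product_prob_space_indep_components) unfold_locales
  have "M.indep_vars (\<lambda>k. PiM (K k) (\<lambda>_. measure_pmf \<mu>)) (\<lambda>k x. restrict (\<lambda>i. x i) (K k)) UNIV"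
    by (rule M.indep_vars_restrict[OF indep _ disj]) auto
  \<comment> \<open>The event is read off the restriction to the window \<open>K k\<close>, so that
    independence of the restrictions applies.\<close>
  then have "M.indep_events (\<lambda>k. {x \<in> space M. \<not> Q k (restrict x (K k))}) UNIV"
  proof (rule M.indep_eventsI_indep_vars)
    fix k
    have "(\<lambda>y. y (pos k i)) \<in> measurable (PiM (K k) (\<lambda>_. measure_pmf \<mu>)) (count_space UNIV)" if "i < N" for i
      using measurable_component_singleton[of "pos k i" "K k" "\<lambda>_. measure_pmf \<mu>"] that by (auto simp: K_def)
    then have "(\<lambda>y. y (pos k i)) -` {w i} \<inter> space (PiM (K k) (\<lambda>_. measure_pmf \<mu>)) \<in> sets (PiM (K k) (\<lambda>_. measure_pmf \<mu>))"
      if "i < N" for i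
      using that by (auto intro!: measurable_sets)
    then have "space (PiM (K k) (\<lambda>_. measure_pmf \<mu>))
       - (\<Inter>i\<in>{..<N}. (\<lambda>y. y (pos k i)) -` {w i} \<inter> space (PiM (K k) (\<lambda>_. measure_pmf \<mu>)))
       \<in> sets (PiM (K k) (\<lambda>_. measure_pmf \<mu>))"
      using False by (intro sets.compl_sets sets.finite_INT) auto
    also have "space (PiM (K k) (\<lambda>_. measure_pmf \<mu>))
       - (\<Inter>i\<in>{..<N}. (\<lambda>y. y (pos k i)) -` {w i} \<inter> space (PiM (K k) (\<lambda>_. measure_pmf \<mu>)))
       = {y \<in> space (PiM (K k) (\<lambda>_. measure_pmf \<mu>)). \<not> Q k y}"
      using False unfolding Q_def by auto
    finally show "{y \<in> space (PiM (K k) (\<lambda>_. measure_pmf \<mu>)). \<not> Q k y} \<in> sets (PiM (K k) (\<lambda>_. measure_pmf \<mu>))" .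
  qed
  moreover have "Q k (restrict x (K k)) \<longleftrightarrow> Q k x" for k x
    unfolding Q_def K_def by auto
  ultimately have ind: "M.indep_events (\<lambda>k. {x \<in> space M. \<not> Q k x}) UNIV" by simp
  define A where "A = (\<lambda>k. {x \<in> space M. \<not> Q k x})"
  have A_events: "A k \<in> M.events" for k
    using ind unfolding M.indep_events_def A_def by auto
  define q where "q = (\<Prod>i<N. pmf \<mu> (w i))"
  have q: "0 < q" unfolding q_def using w by (intro prod_pos) (auto simp: pmf_positive)
  have "M.prob {x \<in> space M. Q k x} = q" for k
  proof -
    have "{x \<in> space M. Q k x} = {x \<in> space M. \<forall>n\<in>K k. x n \<in> {w (nat (n - pos k 0))}}"
      unfolding Q_def K_def pos_def by auto
    then have "emeasure M {x \<in> space M. Q k x} = (\<Prod>n\<in>K k. emeasure (measure_pmf \<mu>) {w (nat (n - pos k 0))})"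
      unfolding M_def by (simp only:) (rule emeasure_PiM_Collect, auto simp: K_def)
    also have "\<dots> = (\<Prod>i<N. emeasure (measure_pmf \<mu>) {w i})"
      unfolding K_def by (subst prod.reindex[OF inj]) (auto simp: pos_def intro!: prod.cong)
    also have "\<dots> = ennreal q"
      unfolding q_def by (simp add: emeasure_pmf_single prod_ennreal)
    finally show ?thesis using q by (simp add: measure_def)
  qed
  moreover have "A k = space M - {x \<in> space M. Q k x}" for k unfolding A_def by auto
  moreover have "{x \<in> space M. Q k x} = space M - A k" for k unfolding A_def by auto
  ultimately have prob_A: "M.prob (A k) = 1 - q" for k
    using A_events by (metis M.prob_compl sets.compl_sets)
  have q1: "0 \<le> 1 - q" using prob_A[of 0] by (metis measure_nonneg)
  have inter: "(\<Inter>k. A k) \<in> M.events" using A_events by auto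
  have "M.prob (\<Inter>k. A k) \<le> (1 - q) ^ n" if "0 < n" for n
  proof -
    have "M.prob (\<Inter>k. A k) \<le> M.prob (\<Inter>k<n. A k)"
      using A_events that by (intro M.finite_measure_mono sets.finite_INT) auto
    also have "\<dots> = (\<Prod>k<n. M.prob (A k))"
      using ind that unfolding M.indep_events_def A_def[symmetric]
      by (metis finite_lessThan lessThan_empty_iff not_gr_zero subset_UNIV)
    finally show ?thesis by (simp add: prob_A)
  qed
  moreover have "(\<lambda>n. (1 - q) ^ n) \<longlonglongrightarrow> 0"
    using q q1 by (intro LIMSEQ_power_zero) auto
  ultimately have "M.prob (\<Inter>k. A k) \<le> 0"
    by (intro LIMSEQ_le_const[of "\<lambda>n. (1 - q) ^ n"] exI[of _ 1]) auto
  then have "M.prob (\<Inter>k. A k) = 0" by (simp add: measure_le_0_iff)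
  then have "AE x in M. x \<notin> (\<Inter>k. A k)"
    using M.prob_eq_0[OF inter] by simp
  then show ?thesis
    unfolding M_def[symmetric] by eventually_elim (auto simp: A_def Q_def pos_def M_def space_PiM)
qed

section \<open>Almost sure statements for the product measure\<close>

lemma AE_nu_fst:
  assumes "AE x in PiM UNIV (\<lambda>_::int. measure_pmf \<mu>). P x"
  shows "AE \<omega> in nu \<mu>. P (fst \<omega>)"
proof -
  have "distr (nu \<mu>) (PiM UNIV (\<lambda>_::int. measure_pmf \<mu>)) fst = PiM UNIV (\<lambda>_::int. measure_pmf \<mu>)"
    unfolding nu_def by (rule measure_pmf.distr_pair_fst)
  moreover have "fst \<in> measurable (nu \<mu>) (PiM UNIV (\<lambda>_::int. measure_pmf \<mu>))"
    unfolding nu_def by simp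
  ultimately show ?thesis
    using AE_distrD[of fst "nu \<mu>" "PiM UNIV (\<lambda>_::int. measure_pmf \<mu>)" P] assms by metis
qed

lemma AE_nu_snd: "AE \<omega> in nu \<mu>. snd \<omega> \<in> {0, 1}"
proof -
  interpret product_prob_space "\<lambda>_::int. measure_pmf \<mu>" UNIV by unfold_locales
  interpret pair_sigma_finite "PiM UNIV (\<lambda>_::int. measure_pmf \<mu>)" "measure_pmf (pmf_of_set {0, 1::nat})"
    by unfold_locales
  have "AE j in measure_pmf (pmf_of_set {0, 1::nat}). j \<in> {0, 1}"
    by (simp add: AE_measure_pmf_iff)
  moreover have "{\<omega> \<in> space (nu \<mu>). snd \<omega> \<in> {0, 1}} \<in> sets (nu \<mu>)"
    using measurable_sets[of snd "nu \<mu>" "measure_pmf (pmf_of_set {0, 1::nat})" "{0, 1}"]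
    by (simp add: nu_def vimage_def Int_def conj_commute del: One_nat_def)
  ultimately show ?thesis
    unfolding nu_def by (intro AE_pair_measure) (simp_all del: One_nat_def)
qed

theorem theorem3p51:
  fixes m :: nat and \<mu>0 :: "nat pmf" and g :: "nat \<Rightarrow> nat \<Rightarrow> real"
  assumes "set_pmf \<mu>0 = {1..m}"
  shows "(AE \<omega> in nu \<mu>0. op_spectrum (pot g \<omega>) =
            (\<Union>a\<in>{1..m}. \<Union>b\<in>{1..m}. op_spectrum (pot g (omega_ab a b))))
       \<and> (\<forall>\<omega>\<in>XZ2 m. op_spectrum (pot g \<omega>) \<subseteq>
            (\<Union>a\<in>{1..m}. \<Union>b\<in>{1..m}. op_spectrum (pot g (omega_ab a b))))"
  unfolding op_spectrum_omega_ab
proof (intro conjI ballI)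
  show "op_spectrum (pot g \<omega>) \<subseteq> (\<Union>a\<in>{1..m}. \<Union>b\<in>{1..m}. band (g a 0) (g b 1))"
    if "\<omega> \<in> XZ2 m" for \<omega>
    using that by (rule op_spectrum_pot_subset)
  let ?M = "PiM UNIV (\<lambda>_::int. measure_pmf \<mu>0)"
  \<comment> \<open>A site beyond \<open>N\<close> with the parity of \<open>j\<close>: for either
    value of the second coordinate, the potential there reads \<open>g\<close> at phase 0.\<close>
  define start where "start = (\<lambda>(N::int) (j::nat). 2 * (\<bar>N\<bar> + 1) + int j)"
  have "AE x in ?M. x n \<in> {1..m}" for n
    using assms by (intro AE_PiM_component) (auto simp: AE_measure_pmf_iff prob_space_measure_pmf)
  then have range: "AE x in ?M. \<forall>n. x n \<in> {1..m}" by (simp add: AE_all_countable)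
  \<comment> \<open>All parameters range over countable types, so the exceptional null sets can be
    united.\<close>
  have "AE x in ?M. a \<in> {1..m} \<longrightarrow> b \<in> {1..m} \<longrightarrow>
      (\<exists>k. \<forall>i<2 * L. x (start N j + int (k * (2 * L) + i)) = (if even i then a else b))" for a b j L N
    using AE_word_occurs[of "2 * L" "\<lambda>i. if even i then a else b" \<mu>0 "start N j"] assms
    by (cases "a \<in> {1..m} \<and> b \<in> {1..m}") auto
  then have "AE x in ?M. \<forall>a b j L N. a \<in> {1..m} \<longrightarrow> b \<in> {1..m} \<longrightarrow>
      (\<exists>k. \<forall>i<2 * L. x (start N j + int (k * (2 * L) + i)) = (if even i then a else b))"
    by (simp add: AE_all_countable)
  from AE_nu_fst[OF this] AE_nu_fst[OF range] AE_nu_snd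
  show "AE \<omega> in nu \<mu>0. op_spectrum (pot g \<omega>) = (\<Union>a\<in>{1..m}. \<Union>b\<in>{1..m}. band (g a 0) (g b 1))"
  proof eventually_elim
    case (elim \<omega>)
    obtain x j where \<omega>: "\<omega> = (x, j)" by (cases \<omega>)
    have j: "j = 0 \<or> j = 1" using elim(3) \<omega> by simp
    have "\<omega> \<in> XZ2 m" using elim(2) j by (simp add: XZ2_def \<omega>)
    moreover have "band (g a 0) (g b 1) \<subseteq> op_spectrum (pot g \<omega>)" if ab: "a \<in> {1..m}" "b \<in> {1..m}" for a b
    proof (rule band_subset_op_spectrum)
      show "has_blocks (pot g \<omega>) (g a 0) (g b 1)"
        unfolding has_blocks_def
      proof (intro allI)
        fix L :: nat and N :: int
        obtain k where k: "\<forall>i<2 * L. x (start N j + int (k * (2 * L) + i)) = (if even i then a else b)"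
          using elim(1)[rule_format, OF ab] unfolding \<omega> fst_conv by blast
        define s where "s = start N j + int (k * (2 * L))"
        \<comment> \<open>Windows have even length \<open>2 * L\<close>, so moving by
          \<open>k\<close> of them keeps the parity of \<open>start N j\<close>.\<close>
        have par: "even (s + int i) \<longleftrightarrow> (even i \<longleftrightarrow> j = 0)" for i
          using j by (auto simp: s_def start_def)
        have "pot g \<omega> (s + int i) = (if even i then g a 0 else g b 1)" if "i < 2 * L" for i
          using k[rule_format, OF that] j par[of i] unfolding \<omega>
          by (subst pot_eq) (auto simp: s_def add.assoc)
        moreover have "N < s" by (simp add: s_def start_def) (smt (verit) of_nat_0_le_iff mult_nonneg_nonneg)
        ultimately show "\<exists>s>N. \<forall>i<2 * L. pot g \<omega> (s + int i) = (if even i then g a 0 else g b 1)"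
          by blast
      qed
    qed
    ultimately show ?case using op_spectrum_pot_subset[of \<omega> m g] by blast
  qed
qed

end
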